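(* Let $A, B \in M_2(\bar{\mathbb{R}})$. Then the following are equivalent: (i) $A \mathcal{D} B$; (ii) $A \mathcal{J} B$; (iii) $PC(A) \cong PC(B)$; (iv) $PR(A) \cong PR(B)$.
   Context: $\bar{\mathbb{R}} = \mathbb{R} \cup \{-\infty\}$ is the tropical semiring with $a \otimes b = a+b$ (with $-\infty$ absorbing) and $a \oplus b = \max\{a,b\}$. $M_2(\bar{\mathbb{R}})$ is the monoid of $2 \times 2$ matrices over $\bar{\mathbb{R}}$ under tropical matrix multiplication $(AB)_{ij} = \max_{k} (A_{ik} + B_{kj})$. In a monoid $S$: $A \mathcal{R} B$ means $AS=BS$; $A \mathcal{L} B$ means $SA=SB$; $A \mathcal{J} B$ means $SAS=SBS$; $\mathcal{D}$ is the smallest equivalence relation containing $\mathcal{L}$ and $\mathcal{R}$ (equivalently, $A\mathcal{D}B$ iff there is $Z\in S$ with $A\mathcal{R}Z$ and $Z\mathcal{L}B$). The column space $C(A)$ (respectively row space $R(A)$) is the set of all tropical linear combinations in $\bar{\mathbb{R}}^2$ of the columns (respectively rows) of $A$. Let $\hat{\mathbb{R}} = \mathbb{R} \cup \{-\infty,\infty\}$. Each non-zero vector $(a,b) \in \bar{\mathbb{R}}^2$ (i.e. $(a,b)\neq(-\infty,-\infty)$) is projected to the point of $\hat{\mathbb{R}}$ equal to $b-a$ if $a,b$ are real, $\infty$ if $a=-\infty$, and $-\infty$ if $b=-\infty$. $PC(A), PR(A) \subseteq \hat{\mathbb{R}}$ are the images under this projection of the non-zero vectors of $C(A)$ and $R(A)$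 respectively. The distance $\delta$ on $\hat{\mathbb{R}}$ (with values in $\mathbb{R}\cup\{\infty\}$) is $\delta(x,y) = |y-x|$ if $x,y \in \mathbb{R}$; $\delta(x,y)=0$ if $x=y=-\infty$ or $x=y=\infty$; and $\delta(x,y)=\infty$ otherwise. For $M,N\subseteq\hat{\mathbb{R}}$, $M\cong N$ means there is a bijection $M\to N$ preserving $\delta$ (not required to preserve orientation). *)

theory Defs
  imports "HOL-Analysis.Analysis" "HOL-Algebra.Coset"
begin

text \<open>
  The tropical semiring: reals with an extra element \<open>NegInf\<close> for \<open>-\<infinity>\<close>. The class operations
  \<open>+\<close> and \<open>*\<close> are tropical addition (maximum) and tropical multiplication (ordinary sum), so
  \<open>0 = -\<infinity>\<close> and \<open>1 = Fin 0\<close>. With this instance, the product \<open>**\<close> of HOL-Analysis is tropical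
  matrix multiplication.
\<close>

datatype trop = NegInf | Fin real

instantiation trop :: comm_semiring_1
begin

definition zero_trop :: trop where "0 = NegInf"

definition one_trop :: trop where "1 = Fin 0"

fun plus_trop :: "trop \<Rightarrow> trop \<Rightarrow> trop" where
  "NegInf + y = y"
| "Fin a + NegInf = Fin a"
| "Fin a + Fin b = Fin (max a b)"

fun times_trop :: "trop \<Rightarrow> trop \<Rightarrow> trop" where
  "NegInf * y = NegInf"
| "Fin a * NegInf = NegInf"
| "Fin a * Fin b = Fin (a + b)"

instance
proof
  fix a b c :: trop
  show "a + b + c = a + (b + c)" by (cases a; cases b; cases c) simp_all
  show "a + b = b + a" by (cases a; cases b) simp_all
  show "0 + a = a" by (simp add: zero_trop_def)
  show "a * b * c = a * (b * c)" by (cases a; cases b; cases c) simp_all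
  show "a * b = b * a" by (cases a; cases b) simp_all
  show "1 * a = a" by (cases a) (simp_all add: one_trop_def)
  show "(a + b) * c = a * c + b * c" by (cases a; cases b; cases c) (simp_all add: max_def)
  show "0 * a = 0" by (simp add: zero_trop_def)
  show "a * 0 = 0" by (cases a) (simp_all add: zero_trop_def)
  show "(0::trop) \<noteq> 1" by (simp add: zero_trop_def one_trop_def)
qed

end

text \<open>
  Green's relations of a monoid, through its principal right, left and two-sided ideals
  \<open>aS\<close>, \<open>Sa\<close> and \<open>SaS\<close>.
\<close>

definition green_R :: "('a, 'b) monoid_scheme \<Rightarrow> 'a rel" where
  "green_R S = {(a, b). a \<in> carrier S \<and> b \<in> carrier S \<and>
     a <#\<^bsub>S\<^esub> carrier S = b <#\<^bsub>S\<^esub> carrier S}"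

definition green_L :: "('a, 'b) monoid_scheme \<Rightarrow> 'a rel" where
  "green_L S = {(a, b). a \<in> carrier S \<and> b \<in> carrier S \<and>
     carrier S #>\<^bsub>S\<^esub> a = carrier S #>\<^bsub>S\<^esub> b}"

definition green_J :: "('a, 'b) monoid_scheme \<Rightarrow> 'a rel" where
  "green_J S = {(a, b). a \<in> carrier S \<and> b \<in> carrier S \<and>
     (carrier S #>\<^bsub>S\<^esub> a) <#>\<^bsub>S\<^esub> carrier S = (carrier S #>\<^bsub>S\<^esub> b) <#>\<^bsub>S\<^esub> carrier S}"

definition green_D :: "('a, 'b) monoid_scheme \<Rightarrow> 'a rel" where
  "green_D S = \<Inter>{E. equiv (carrier S) E \<and> green_L S \<subseteq> E \<and> green_R S \<subseteq> E}"

text \<open>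
  The class operation \<open>*\<close> on vectors and matrices is componentwise, so the matrix monoid is
  given as an explicit record over \<open>**\<close>.
\<close>

definition M2 :: "(trop^2^2) monoid" where
  "M2 = \<lparr>carrier = UNIV, mult = (**), one = mat 1\<rparr>"

lemma monoid_M2: "monoid M2"
  by (rule monoidI) (simp_all add: M2_def matrix_mul_assoc)

definition col_space :: "trop^2^2 \<Rightarrow> (trop^2) set" where
  "col_space A = range (\<lambda>c :: trop^2. \<Sum>j\<in>UNIV. c $ j *s column j A)"

definition row_space :: "trop^2^2 \<Rightarrow> (trop^2) set" where
  "row_space A = range (\<lambda>c :: trop^2. \<Sum>i\<in>UNIV. c $ i *s row i A)"

text \<open>
  \<open>proj v\<close> is meaningful only for \<open>v \<noteq> 0\<close>, i.e. when the entries are not both \<open>-\<infinity>\<close>.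
\<close>

definition proj :: "trop^2 \<Rightarrow> ereal" where
  "proj v = (case (v $ 1, v $ 2) of
       (Fin a, Fin b) \<Rightarrow> ereal (b - a)
     | (NegInf, _) \<Rightarrow> \<infinity>
     | (Fin a, NegInf) \<Rightarrow> -\<infinity>)"

definition PC :: "trop^2^2 \<Rightarrow> ereal set" where
  "PC A = proj ` (col_space A - {0})"

definition PR :: "trop^2^2 \<Rightarrow> ereal set" where
  "PR A = proj ` (row_space A - {0})"

definition delta :: "ereal \<Rightarrow> ereal \<Rightarrow> ereal" where
  "delta x y =
     (if x \<notin> {-\<infinity>, \<infinity>} \<and> y \<notin> {-\<infinity>, \<infinity>} then \<bar>y - x\<bar>
      else if x = y then 0
      else \<infinity>)"

definition delta_isometric :: "ereal set \<Rightarrow> ereal set \<Rightarrow> bool" where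
  "delta_isometric M N \<longleftrightarrow>
     (\<exists>f. bij_betw f M N \<and> (\<forall>x\<in>M. \<forall>y\<in>M. delta (f x) (f y) = delta x y))"

end

theory Submission
  imports Defs
begin

text \<open>
  All four conditions are compared with one numerical invariant of a projective space: the set
  \<open>triple_dists\<close> of the distances within triples of its points. It is preserved by isometries and
  it grows with the set.

  Scaling and permuting the rows and columns of a \<open>2 \<times> 2\<close> matrix, together with an exchange of
  factors for matrices of rank one, leads from any matrix to the zero matrix, to the
  identity, or to a matrix whose entries are \<open>1 = Fin 0\<close> except for a corner \<open>-\<infinity>\<close> or \<open>Fin t\<close> with
  \<open>t \<ge> 0\<close> (\<open>ex_similar_normal_form\<close>). Every one of these steps stays within a \<open>\<D>\<close>-class and changes
  the projective column and row spaces by isometries only. The column spaces of the normal forms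
  are the empty set, the whole of \<open>ereal\<close>, the ray \<open>[-\<infinity>, 0]\<close> and the interval \<open>[0, t]\<close>; the
  invariant tells them apart (\<open>normal_form_unique\<close>). So two matrices with the same invariant share
  their normal form, and then they are \<open>\<D>\<close>-related with isometric column spaces and isometric row
  spaces (\<open>similar_iff_triple_dists_eq\<close>).

  The link with \<open>\<J>\<close> comes from the symmetry of the normal forms: it gives the column space and
  the row space of any matrix the same invariant (\<open>triple_dists_PC_eq_PR\<close>). Multiplying on
  the right shrinks the column space and multiplying on the left shrinks the row space, so the
  invariant of \<open>X ** B ** Y\<close> is contained in that of \<open>B\<close>, and \<open>\<J>\<close>-related matrices have equal
  invariants (\<open>green_J_imp_triple_dists_eq\<close>).
\<close>

section \<open>Green's relations in a monoid\<close>

lemma (in monoid) green_RI: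
  assumes "a \<in> carrier G" "b \<in> carrier G" "x \<in> carrier G" "y \<in> carrier G"
    and "a = b \<otimes> x" "b = a \<otimes> y"
  shows "(a, b) \<in> green_R G"
proof -
  have sub: "c \<otimes> z <# carrier G \<subseteq> c <# carrier G" if "c \<in> carrier G" "z \<in> carrier G" for c z
    using that by (auto simp: l_coset_def m_assoc)
  have "a <# carrier G = b <# carrier G"
    using sub[OF assms(2,3)] sub[OF assms(1,4)] assms(5,6) by (metis subset_antisym)
  then show ?thesis using assms(1,2) by (simp add: green_R_def)
qed

lemma (in monoid) green_R_divides:
  assumes "(a, b) \<in> green_R G"
  obtains x where "x \<in> carrier G" "a = b \<otimes> x"
proof -
  have "a \<in> carrier G" "a <# carrier G = b <# carrier G"
    using assms by (auto simp: green_R_def)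
  moreover have "a = a \<otimes> \<one>"
    using \<open>a \<in> carrier G\<close> by simp
  then have "a \<in> a <# carrier G"
    unfolding l_coset_def by blast
  ultimately show thesis using that by (auto simp: l_coset_def)
qed

lemma (in monoid) green_LI:
  assumes "a \<in> carrier G" "b \<in> carrier G" "x \<in> carrier G" "y \<in> carrier G"
    and "a = x \<otimes> b" "b = y \<otimes> a"
  shows "(a, b) \<in> green_L G"
proof -
  have sub: "carrier G #> z \<otimes> c \<subseteq> carrier G #> c" if "c \<in> carrier G" "z \<in> carrier G" for c z
    using that by (auto simp: r_coset_def m_assoc[symmetric])
  have "carrier G #> a = carrier G #> b"
    using sub[OF assms(2,3)] sub[OF assms(1,4)] assms(5,6) by (metis subset_antisym)
  then show ?thesis using assms(1,2) by (simp add: green_L_def)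
qed

lemma (in monoid) green_L_divides:
  assumes "(a, b) \<in> green_L G"
  obtains x where "x \<in> carrier G" "a = x \<otimes> b"
proof -
  have "a \<in> carrier G" "carrier G #> a = carrier G #> b"
    using assms by (auto simp: green_L_def)
  moreover have "a = \<one> \<otimes> a"
    using \<open>a \<in> carrier G\<close> by simp
  then have "a \<in> carrier G #> a"
    unfolding r_coset_def by blast
  ultimately show thesis using that by (auto simp: r_coset_def)
qed

lemma green_R_sym: "(a, b) \<in> green_R S \<Longrightarrow> (b, a) \<in> green_R S"
  by (simp add: green_R_def)

lemma green_L_sym: "(a, b) \<in> green_L S \<Longrightarrow> (b, a) \<in> green_L S"
  by (simp add: green_L_def)

lemma (in monoid) green_J_divides:
  assumes "(a, b) \<in> green_J G"
  obtains x y where "x \<in> carrier G" "y \<in> carrier G" "a = x \<otimes> b \<otimes> y"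
proof -
  have "a \<in> carrier G"
    "(carrier G #> a) <#> carrier G = (carrier G #> b) <#> carrier G"
    using assms by (auto simp: green_J_def)
  moreover have "a = \<one> \<otimes> a \<otimes> \<one>"
    using \<open>a \<in> carrier G\<close> by simp
  then have "a \<in> (carrier G #> a) <#> carrier G"
    unfolding r_coset_def set_mult_def by blast
  ultimately show thesis using that by (auto simp: r_coset_def set_mult_def)
qed

lemma green_J_sym: "(a, b) \<in> green_J S \<Longrightarrow> (b, a) \<in> green_J S"
  by (simp add: green_J_def)

lemma equiv_green_D: "equiv (carrier S) (green_D S)"
proof (rule equivI)
  have "equiv (carrier S) (carrier S \<times> carrier S)"
    by (auto intro!: equivI simp: refl_on_def sym_def trans_def)
  moreover have "green_L S \<union> green_R S \<subseteq> carrier S \<times> carrier S"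
    by (auto simp: green_L_def green_R_def)
  ultimately show "green_D S \<subseteq> carrier S \<times> carrier S"
    unfolding green_D_def by blast
  show "refl_on (carrier S) (green_D S)"
    unfolding green_D_def equiv_def refl_on_def by blast
  show "sym (green_D S)"
    unfolding green_D_def equiv_def by (rule symI) (blast dest: symD)
  show "trans (green_D S)"
    unfolding green_D_def equiv_def by (rule transI) (blast dest: transD)
qed

lemma green_D_refl: "a \<in> carrier S \<Longrightarrow> (a, a) \<in> green_D S"
  using equiv_green_D[of S] by (simp add: equiv_def refl_on_def)

lemma green_D_sym: "(a, b) \<in> green_D S \<Longrightarrow> (b, a) \<in> green_D S"
  using equiv_green_D[of S] unfolding equiv_def sym_def by blast

lemma green_D_trans: "(a, b) \<in> green_D S \<Longrightarrow> (b, c) \<in> green_D S \<Longrightarrow> (a, c) \<in> green_D S"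
  using equiv_green_D[of S] unfolding equiv_def trans_def by blast

lemma green_L_subset_D: "green_L S \<subseteq> green_D S"
  by (auto simp: green_D_def)

lemma green_R_subset_D: "green_R S \<subseteq> green_D S"
  by (auto simp: green_D_def)

lemma green_D_least:
  assumes "equiv (carrier S) E" "green_L S \<subseteq> E" "green_R S \<subseteq> E"
  shows "green_D S \<subseteq> E"
  using assms by (auto simp: green_D_def)

lemma (in monoid) green_D_subset_J: "green_D G \<subseteq> green_J G"
proof (rule green_D_least)
  show "equiv (carrier G) (green_J G)"
    by (auto intro!: equivI simp: green_J_def refl_on_def sym_def trans_def)
  \<comment> \<open>The two-sided ideal of \<open>a\<close> is determined by its left ideal and also by its right ideal.\<close>
  show "green_L G \<subseteq> green_J G"
    by (auto simp: green_L_def green_J_def)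
  have "(carrier G #> a) <#> carrier G = carrier G <#> (a <# carrier G)" if "a \<in> carrier G" for a
    using that by (fastforce simp: r_coset_def l_coset_def set_mult_def m_assoc)
  then show "green_R G \<subseteq> green_J G"
    by (auto simp: green_R_def green_J_def)
qed

section \<open>Isometries and triples of distances\<close>

lemma delta_eq_0_iff: "delta x y = 0 \<longleftrightarrow> x = y"
  by (cases x; cases y) (auto simp: delta_def zero_ereal_def)

lemma delta_self: "delta x x = 0"
  by (simp add: delta_eq_0_iff)

lemma delta_eq_PInfty_iff: "delta x y = \<infinity> \<longleftrightarrow> x \<noteq> y \<and> (\<bar>x\<bar> = \<infinity> \<or> \<bar>y\<bar> = \<infinity>)"
  by (cases x; cases y) (auto simp: delta_def)

lemma delta_isometric_refl: "delta_isometric M M"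
  unfolding delta_isometric_def by (auto intro!: exI[of _ id])

lemma delta_isometric_trans:
  assumes "delta_isometric M N" "delta_isometric N P"
  shows "delta_isometric M P"
proof -
  obtain f g where f: "bij_betw f M N" "\<And>x y. x \<in> M \<Longrightarrow> y \<in> M \<Longrightarrow> delta (f x) (f y) = delta x y"
    and g: "bij_betw g N P" "\<And>x y. x \<in> N \<Longrightarrow> y \<in> N \<Longrightarrow> delta (g x) (g y) = delta x y"
    using assms unfolding delta_isometric_def by blast
  have "bij_betw (g \<circ> f) M P" using f g by (blast intro: bij_betw_trans)
  moreover have "delta ((g \<circ> f) x) ((g \<circ> f) y) = delta x y" if "x \<in> M" "y \<in> M" for x y
    using that f g bij_betwE[OF f(1)] by simp
  ultimately show ?thesis unfolding delta_isometric_def by blast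
qed

lemma delta_isometric_sym:
  assumes "delta_isometric M N"
  shows "delta_isometric N M"
proof -
  obtain f where f: "bij_betw f M N" "\<And>x y. x \<in> M \<Longrightarrow> y \<in> M \<Longrightarrow> delta (f x) (f y) = delta x y"
    using assms unfolding delta_isometric_def by blast
  let ?g = "the_inv_into M f"
  have g: "bij_betw ?g N M" using f(1) by (rule bij_betw_the_inv_into)
  have "delta (?g x) (?g y) = delta x y" if "x \<in> N" "y \<in> N" for x y
    using that f bij_betwE[OF g] f_the_inv_into_f_bij_betw[OF f(1)] by metis
  with g show ?thesis unfolding delta_isometric_def by blast
qed

text \<open>Injectivity is automatic, because \<open>delta\<close> separates points.\<close>

lemma delta_isometric_image:
  assumes "\<And>x y. x \<in> M \<Longrightarrow> y \<in> M \<Longrightarrow> delta (f x) (f y) = delta x y"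
  shows "delta_isometric M (f ` M)"
proof -
  have "inj_on f M"
    using assms by (metis delta_eq_0_iff inj_onI)
  then show ?thesis
    using assms unfolding delta_isometric_def by (auto intro!: exI[of _ f] inj_on_imp_bij_betw)
qed

text \<open>
  The set of distances alone does not separate a ray together with its end at infinity from the
  whole of \<open>ereal\<close>: both realise \<open>0\<close>, \<open>\<infinity>\<close> and all positive reals. The distances within triples
  do, because only in the whole line are there three points at mutual distance \<open>\<infinity>\<close>.
\<close>

definition triple_dists :: "ereal set \<Rightarrow> (ereal \<times> ereal \<times> ereal) set" where
  "triple_dists M = {(delta x y, delta y z, delta x z) | x y z. x \<in> M \<and> y \<in> M \<and> z \<in> M}"

lemma triple_dists_mono: "M \<subseteq> N \<Longrightarrow> triple_dists M \<subseteq> triple_dists N"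
  by (fastforce simp: triple_dists_def)

lemma delta_isometric_imp_triple_dists_eq:
  assumes "delta_isometric M N"
  shows "triple_dists M = triple_dists N"
proof -
  have sub: "triple_dists M \<subseteq> triple_dists N" if iso: "delta_isometric M N" for M N
  proof -
    obtain f where f: "bij_betw f M N" "\<And>x y. x \<in> M \<Longrightarrow> y \<in> M \<Longrightarrow> delta (f x) (f y) = delta x y"
      using iso unfolding delta_isometric_def by blast
    have "(delta x y, delta y z, delta x z) \<in> triple_dists N" if "x \<in> M" "y \<in> M" "z \<in> M" for x y z
      unfolding triple_dists_def
      using f that bij_betwE[OF f(1)]
      by (intro CollectI exI[of _ "f x"] exI[of _ "f y"] exI[of _ "f z"]) simp
    then show ?thesis by (auto simp: triple_dists_def)
  qed
  show ?thesis using sub[OF assms] sub[OF delta_isometric_sym[OF assms]] by blast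
qed

section \<open>Projective column and row spaces\<close>

lemma col_space_eq_range: "col_space A = range ((*v) A)"
proof -
  have "(*v) A = (\<lambda>c. \<Sum>j\<in>UNIV. c $ j *s column j A)"
    by (rule ext) (rule matrix_mult_sum)
  then show ?thesis by (simp add: col_space_def)
qed

lemma PR_eq_PC_transpose: "PR A = PC (transpose A)"
  by (simp only: PR_def PC_def row_space_def col_space_def column_transpose)

lemma mem_PC_iff: "x \<in> PC A \<longleftrightarrow> (\<exists>c. A *v c \<noteq> 0 \<and> x = proj (A *v c))"
  unfolding PC_def col_space_eq_range by blast

lemma PC_mult_right_subset: "PC (A ** B) \<subseteq> PC A"
proof
  fix x
  assume "x \<in> PC (A ** B)"
  then obtain c where "A *v (B *v c) \<noteq> 0" "x = proj (A *v (B *v c))"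
    unfolding mem_PC_iff matrix_vector_mul_assoc by blast
  then show "x \<in> PC A" unfolding mem_PC_iff by blast
qed

lemma PR_mult_left_subset: "PR (A ** B) \<subseteq> PR B"
  unfolding PR_eq_PC_transpose matrix_transpose_mul by (rule PC_mult_right_subset)

text \<open>
  Right multiplication only restricts the column space, whereas left multiplication by \<open>U\<close>
  transforms it. If \<open>U\<close> kills no nonzero vector, the transformation descends to projective points.
\<close>

lemma PC_mult_left_image:
  assumes "\<And>v. v \<noteq> 0 \<Longrightarrow> U *v v \<noteq> 0" "\<And>v. v \<noteq> 0 \<Longrightarrow> proj (U *v v) = f (proj v)"
  shows "PC (U ** A) = f ` PC A"
proof -
  have nz: "U *v v \<noteq> 0 \<longleftrightarrow> v \<noteq> 0" for v
    using assms(1)[of v] matrix_vector_mult_0_right[of U] by metis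
  have "x \<in> PC (U ** A) \<longleftrightarrow> (\<exists>c. A *v c \<noteq> 0 \<and> x = f (proj (A *v c)))" for x
    unfolding mem_PC_iff matrix_vector_mul_assoc[symmetric] nz using assms(2) by metis
  moreover have "x \<in> f ` PC A \<longleftrightarrow> (\<exists>c. A *v c \<noteq> 0 \<and> x = f (proj (A *v c)))" for x
    unfolding image_iff Bex_def mem_PC_iff by blast
  ultimately show ?thesis by blast
qed

section \<open>Similarity of matrices\<close>

text \<open>
  All the relations that are to be proved equivalent, except for \<open>\<J>\<close>, at once: the reduction to
  normal forms moves through matrices that are related in this strong sense.
\<close>

definition similar :: "trop^2^2 \<Rightarrow> trop^2^2 \<Rightarrow> bool" where
  "similar A B \<longleftrightarrow> (A, B) \<in> green_D M2
     \<and> delta_isometric (PC A) (PC B) \<and> delta_isometric (PR A) (PR B)"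

lemma M2_simps [simp]: "carrier M2 = UNIV" "A \<otimes>\<^bsub>M2\<^esub> B = A ** B" "\<one>\<^bsub>M2\<^esub> = mat 1"
  by (simp_all add: M2_def)

lemma similar_refl: "similar A A"
  by (simp add: similar_def green_D_refl delta_isometric_refl)

lemma similar_sym: "similar A B \<Longrightarrow> similar B A"
  unfolding similar_def by (blast intro: green_D_sym delta_isometric_sym)

lemma similar_trans [trans]: "similar A B \<Longrightarrow> similar B C \<Longrightarrow> similar A C"
  unfolding similar_def by (blast intro: green_D_trans delta_isometric_trans)

text \<open>
  Transposition is an anti-automorphism of the matrix monoid and so exchanges \<open>\<L>\<close> and \<open>\<R>\<close>. It
  turns every statement about rows below into one about columns.
\<close>

lemma green_R_transpose:
  assumes "(A, B) \<in> green_R M2"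
  shows "(transpose A, transpose B) \<in> green_L M2"
proof -
  obtain X Y where "A = B ** X" "B = A ** Y"
    using monoid.green_R_divides[OF monoid_M2] assms green_R_sym by (metis M2_simps(2))
  then have "transpose A = transpose X ** transpose B" "transpose B = transpose Y ** transpose A"
    by (metis matrix_transpose_mul)+
  then show ?thesis
    using monoid.green_LI[OF monoid_M2, of "transpose A" "transpose B" "transpose X" "transpose Y"]
    unfolding M2_simps by blast
qed

lemma green_L_transpose:
  assumes "(A, B) \<in> green_L M2"
  shows "(transpose A, transpose B) \<in> green_R M2"
proof -
  obtain X Y where "A = X ** B" "B = Y ** A"
    using monoid.green_L_divides[OF monoid_M2] assms green_L_sym by (metis M2_simps(2))
  then have "transpose A = transpose B ** transpose X" "transpose B = transpose A ** transpose Y"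
    by (metis matrix_transpose_mul)+
  then show ?thesis
    using monoid.green_RI[OF monoid_M2, of "transpose A" "transpose B" "transpose X" "transpose Y"]
    unfolding M2_simps by blast
qed

lemma green_D_transpose:
  assumes "(A, B) \<in> green_D M2"
  shows "(transpose A, transpose B) \<in> green_D M2"
proof -
  let ?E = "{(A, B). (transpose A, transpose B) \<in> green_D M2}"
  have "green_D M2 \<subseteq> ?E"
  proof (rule green_D_least)
    show "equiv (carrier M2) ?E"
    proof (rule equivI)
      show "refl_on (carrier M2) ?E" by (simp add: refl_on_def green_D_refl)
      show "sym ?E" by (auto simp: sym_def intro: green_D_sym)
      show "trans ?E" unfolding trans_def by (blast intro: green_D_trans)
    qed simp
    show "green_L M2 \<subseteq> ?E" using green_L_transpose green_R_subset_D by fast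
    show "green_R M2 \<subseteq> ?E" using green_R_transpose green_L_subset_D by fast
  qed
  then show ?thesis using assms by blast
qed

lemma similar_transpose: "similar A B \<Longrightarrow> similar (transpose A) (transpose B)"
  by (simp add: similar_def green_D_transpose PR_eq_PC_transpose)

text \<open>
  A left invertible \<open>U\<close> changes neither the row space nor, up to isometry, the column space, as soon
  as it acts on projective points by an isometry.
\<close>

lemma similar_mult_left:
  assumes inv: "V ** U = mat 1"
    and U: "\<And>v. v \<noteq> 0 \<Longrightarrow> proj (U *v v) = f (proj v)"
    and f: "\<And>x y. delta (f x) (f y) = delta x y"
  shows "similar A (U ** A)"
proof -
  have VU: "V ** (U ** C) = C" for C :: "trop^2^2"
    by (simp add: matrix_mul_assoc inv)
  have L: "(A, U ** A) \<in> green_L M2"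
    by (rule monoid.green_LI[OF monoid_M2, of _ _ V U]) (simp_all add: VU)
  have "U *v v \<noteq> 0" if "v \<noteq> 0" for v
    using that inv by (metis matrix_vector_mul_assoc matrix_vector_mul_lid matrix_vector_mult_0_right)
  then have "PC (U ** A) = f ` PC A" using U by (intro PC_mult_left_image)
  then have "delta_isometric (PC A) (PC (U ** A))"
    using delta_isometric_image[of "PC A" f] f by simp
  moreover have "PR (U ** A) = PR A"
    using PR_mult_left_subset[of U A] PR_mult_left_subset[of V "U ** A"] VU by auto
  ultimately show ?thesis
    using L green_L_subset_D by (auto simp: similar_def delta_isometric_refl)
qed

section \<open>Swapping and scaling rows and columns\<close>

abbreviation mat22 :: "trop \<Rightarrow> trop \<Rightarrow> trop \<Rightarrow> trop \<Rightarrow> trop^2^2" where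
  "mat22 a b c d \<equiv> vector [vector [a, b], vector [c, d]]"

lemmas vec2_defs = vec_eq_iff forall_2 sum_2 matrix_matrix_mult_def matrix_vector_mult_def
  transpose_def mat_def

lemma mat22_eta: "A = mat22 (A$1$1) (A$1$2) (A$2$1) (A$2$2)"
  by (simp add: vec2_defs)

lemma transpose_mat22: "transpose (mat22 a b c d) = mat22 a c b d"
  by (simp add: vec2_defs)

lemma similar_swap_rows: "similar (mat22 a b c d) (mat22 c d a b)"
proof -
  let ?U = "mat22 0 1 1 0"
  have "similar (mat22 a b c d) (?U ** mat22 a b c d)"
  proof (rule similar_mult_left)
    show "?U ** ?U = mat 1" by (simp add: vec2_defs)
    \<comment> \<open>Exchanging the coordinates of a vector reverses the sign of their difference.\<close>
    show "proj (?U *v v) = uminus (proj v)" if "v \<noteq> 0" for v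
      using that
      by (cases "v $ 1"; cases "v $ 2") (simp_all add: vec2_defs proj_def zero_trop_def one_trop_def)
    show "delta (- x) (- y) = delta x y" for x y
      by (cases x; cases y) (simp_all add: delta_def abs_minus_commute)
  qed
  also have "?U ** mat22 a b c d = mat22 c d a b" by (simp add: vec2_defs)
  finally show ?thesis .
qed

lemma similar_scale_rows:
  "similar (mat22 a b c d) (mat22 (Fin p * a) (Fin p * b) (Fin q * c) (Fin q * d))"
proof -
  let ?U = "mat22 (Fin p) 0 0 (Fin q)"
  have "similar (mat22 a b c d) (?U ** mat22 a b c d)"
  proof (rule similar_mult_left)
    show "mat22 (Fin (-p)) 0 0 (Fin (-q)) ** ?U = mat 1"
      by (simp add: vec2_defs one_trop_def zero_trop_def)
    show "proj (?U *v v) = proj v + ereal (q - p)" if "v \<noteq> 0" for v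
      using that
      by (cases "v $ 1"; cases "v $ 2") (simp_all add: vec2_defs proj_def zero_trop_def)
    show "delta (x + ereal (q - p)) (y + ereal (q - p)) = delta x y" for x y
      by (cases x; cases y) (simp_all add: delta_def)
  qed
  also have "?U ** mat22 a b c d = mat22 (Fin p * a) (Fin p * b) (Fin q * c) (Fin q * d)"
    by (simp add: vec2_defs)
  finally show ?thesis .
qed

lemma similar_swap_columns: "similar (mat22 a b c d) (mat22 b a d c)"
  using similar_transpose[OF similar_swap_rows[of a c b d]] by (simp add: transpose_mat22)

lemma similar_scale_columns:
  "similar (mat22 a b c d) (mat22 (Fin p * a) (Fin q * b) (Fin p * c) (Fin q * d))"
  using similar_transpose[OF similar_scale_rows[of a c b d p q]] by (simp add: transpose_mat22)

section \<open>Matrices of rank one\<close>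

text \<open>
  Over \<open>trop\<close>, whose nonzero elements are invertible, all nonzero matrices of rank one turn out
  to be similar. Scaling and permuting rows and columns does not achieve this, because it keeps
  the number of zero entries.
\<close>

definition outer :: "trop^2 \<Rightarrow> trop^2 \<Rightarrow> trop^2^2" where
  "outer u v = (\<chi> i j. u $ i * v $ j)"

lemma transpose_outer: "transpose (outer u v) = outer v u"
  by (simp add: outer_def transpose_def vec_eq_iff mult.commute)

lemma ex_dual_vector:
  fixes v :: "trop^2"
  assumes "v \<noteq> 0"
  obtains w :: "trop^2" where "v $ 1 * w $ 1 + v $ 2 * w $ 2 = 1"
proof (cases "v $ 1")
  case (Fin a)
  then show thesis
    by (intro that[of "vector [Fin (-a), 0]"]) (simp add: one_trop_def zero_trop_def[symmetric])
next
  case NegInf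
  with assms obtain b where "v $ 2 = Fin b"
    by (cases "v $ 2") (auto simp: vec2_defs zero_trop_def)
  then show thesis
    by (intro that[of "vector [0, Fin (-b)]"]) (simp add: one_trop_def zero_trop_def[symmetric])
qed

lemma PC_outer:
  assumes "u \<noteq> 0" "v \<noteq> 0"
  shows "PC (outer u v) = {proj u}"
proof -
  have mul: "outer u v *v c = (v $ 1 * c $ 1 + v $ 2 * c $ 2) *s u" for c
    by (simp add: outer_def vec2_defs algebra_simps)
  have scale: "proj (k *s u) = proj u" if "k *s u \<noteq> 0" for k
    using that assms(1)
    by (cases k; cases "u $ 1"; cases "u $ 2") (auto simp: proj_def vec2_defs zero_trop_def)
  obtain w :: "trop^2" where w: "v $ 1 * w $ 1 + v $ 2 * w $ 2 = 1" using ex_dual_vector[OF assms(2)] .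
  have "proj u \<in> PC (outer u v)"
    unfolding mem_PC_iff by (intro exI[of _ w]) (simp add: mul w assms(1))
  moreover have "x = proj u" if "x \<in> PC (outer u v)" for x
    using that scale unfolding mem_PC_iff mul by blast
  ultimately show ?thesis by blast
qed

text \<open>
  The column space of \<open>outer u v\<close> is the line through \<open>u\<close>, whatever \<open>v\<close> is. To replace \<open>v\<close>
  by \<open>v'\<close>, multiply on the right with \<open>outer w v'\<close> for some \<open>w\<close> dual to \<open>v\<close>.
\<close>

lemma similar_outer_right:
  assumes "u \<noteq> 0" "v \<noteq> 0" "v' \<noteq> 0"
  shows "similar (outer u v) (outer u v')"
proof -
  have R: "\<exists>X. outer u v' = outer u v ** X" if v: "v \<noteq> 0" for v v'
  proof -
    obtain w :: "trop^2" where w: "v $ 1 * w $ 1 + v $ 2 * w $ 2 = 1" using ex_dual_vector[OF v] .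
    have "outer u v ** outer w v' = (\<chi> i j. u $ i * (v $ 1 * w $ 1 + v $ 2 * w $ 2) * v' $ j)"
      by (simp add: outer_def vec2_defs algebra_simps)
    also have "\<dots> = outer u v'" by (simp add: w outer_def)
    finally show ?thesis by metis
  qed
  obtain X Y where "outer u v = outer u v' ** X" "outer u v' = outer u v ** Y"
    using R assms by blast
  then have "(outer u v, outer u v') \<in> green_R M2"
    using monoid.green_RI[OF monoid_M2, of "outer u v" "outer u v'" X Y] unfolding M2_simps by blast
  moreover have "delta_isometric {x} {y}" for x y
    using delta_isometric_image[of "{x}" "\<lambda>_. y"] by (simp add: delta_self)
  ultimately show ?thesis
    using assms green_R_subset_D
    by (auto simp: similar_def PR_eq_PC_transpose transpose_outer PC_outer delta_isometric_refl)
qed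

lemma similar_outer:
  assumes "u \<noteq> 0" "v \<noteq> 0" "u' \<noteq> 0" "v' \<noteq> 0"
  shows "similar (outer u v) (outer u' v')"
proof -
  have "similar (outer u v) (outer u v')" using assms by (intro similar_outer_right)
  also have "similar (outer u v') (outer u' v')"
    using similar_transpose[OF similar_outer_right[of v' u u']] assms by (simp add: transpose_outer)
  finally show ?thesis .
qed

section \<open>Normal forms\<close>

text \<open>
  The corner \<open>Fin t\<close> is the length of the projective column space; \<open>t = 0\<close> is the case of rank one.
\<close>

definition normal_forms :: "(trop^2^2) set" where
  "normal_forms = {0, mat 1, mat22 1 1 1 NegInf} \<union> {mat22 1 1 1 (Fin t) | t. t \<ge> 0}"

lemma transpose_normal_form: "N \<in> normal_forms \<Longrightarrow> transpose N = N"
  by (auto simp: normal_forms_def vec2_defs)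

lemma similar_normal_form_NegInf: "similar (mat22 (Fin a) (Fin b) (Fin c) NegInf) (mat22 1 1 1 NegInf)"
  using similar_trans[OF similar_scale_rows[of _ _ _ _ "-a" "-c"]
    similar_scale_columns[of _ _ _ _ 0 "a - b"], of "Fin a" "Fin b" "Fin c" NegInf]
  by (simp add: one_trop_def)

text \<open>
  Scaling cannot change \<open>a + d - b - c\<close>, the tropical quotient of the products of the two
  diagonals, and this number becomes the corner once the other three entries are scaled to \<open>1\<close>.
\<close>

lemma similar_normal_form_Fin:
  obtains t where "t \<ge> 0" "similar (mat22 (Fin a) (Fin b) (Fin c) (Fin d)) (mat22 1 1 1 (Fin t))"
proof -
  have scale: "similar (mat22 (Fin a) (Fin b) (Fin c) (Fin d)) (mat22 1 1 1 (Fin (a + d - b - c)))"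
    for a b c d
    using similar_trans[OF similar_scale_rows[of _ _ _ _ "-a" "-c"]
      similar_scale_columns[of _ _ _ _ 0 "a - b"], of "Fin a" "Fin b" "Fin c" "Fin d"]
    by (simp add: one_trop_def algebra_simps)
  \<comment> \<open>Swapping the rows exchanges the diagonals, which makes a negative corner positive.\<close>
  show thesis
  proof (cases "a + d - b - c \<ge> 0")
    case True
    then show thesis using that scale by blast
  next
    case False
    then show thesis
      using that[of "c + b - d - a"] similar_trans[OF similar_swap_rows scale] by simp
  qed
qed

lemma similar_rank_one:
  assumes "u \<noteq> 0" "v \<noteq> 0"
  shows "similar (outer u v) (mat22 1 1 1 (Fin 0))"
proof -
  have "mat22 1 1 1 (Fin 0) = outer (vector [1, 1]) (vector [1, 1])"
    by (simp add: outer_def vec2_defs one_trop_def)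
  moreover have "vector [1, 1] \<noteq> (0 :: trop^2)" by (simp add: vec2_defs)
  ultimately show ?thesis using similar_outer assms by metis
qed

text \<open>
  A zero row or column leaves rank at most one. Without one, the zero entries are both entries of
  a diagonal, or a single entry that swaps can move to the corner, or absent.
\<close>

lemma ex_similar_normal_form: "\<exists>N\<in>normal_forms. similar A N"
proof -
  obtain a b c d where A: "A = mat22 a b c d" using mat22_eta by blast
  have rank_one: ?thesis if "A = outer u v" for u v
  proof (cases "u = 0 \<or> v = 0")
    case True
    then have "A = 0" using that by (auto simp: outer_def vec2_defs)
    then show ?thesis by (auto simp: normal_forms_def similar_refl)
  next
    case False
    then have "similar A (mat22 1 1 1 (Fin 0))" using that similar_rank_one by simp
    then show ?thesis by (fastforce simp: normal_forms_def)
  qed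
  have triangular: ?thesis if "similar A (mat22 (Fin x) (Fin y) (Fin z) NegInf)" for x y z
    using similar_trans[OF that similar_normal_form_NegInf] unfolding normal_forms_def by blast
  have diagonal: ?thesis if "similar A (mat22 (Fin x) NegInf NegInf (Fin y))" for x y
  proof -
    have "similar (mat22 (Fin x) NegInf NegInf (Fin y)) (mat22 1 0 0 1)"
      using similar_scale_rows[of "Fin x" NegInf NegInf "Fin y" "-x" "-y"]
      by (simp add: one_trop_def zero_trop_def)
    also have "mat22 1 0 0 1 = mat 1" by (simp add: vec2_defs)
    finally have "similar A (mat 1)" by (rule similar_trans[OF that])
    then show ?thesis unfolding normal_forms_def by blast
  qed
  consider (row1) "a = NegInf" "b = NegInf" | (row2) "c = NegInf" "d = NegInf"
    | (col1) "a = NegInf" "c = NegInf" | (col2) "b = NegInf" "d = NegInf"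
    | (diag) x y where "a = Fin x" "d = Fin y" "b = NegInf" "c = NegInf"
    | (anti) x y where "b = Fin x" "c = Fin y" "a = NegInf" "d = NegInf"
    | (a) x y z where "b = Fin x" "c = Fin y" "d = Fin z" "a = NegInf"
    | (b) x y z where "a = Fin x" "c = Fin y" "d = Fin z" "b = NegInf"
    | (c) x y z where "a = Fin x" "b = Fin y" "d = Fin z" "c = NegInf"
    | (d) x y z where "a = Fin x" "b = Fin y" "c = Fin z" "d = NegInf"
    | (full) w x y z where "a = Fin w" "b = Fin x" "c = Fin y" "d = Fin z"
    by (cases a; cases b; cases c; cases d) auto
  then show ?thesis
  proof cases
    case row1
    then have "A = outer (vector [0, 1]) (vector [c, d])"
      by (simp add: A outer_def vec2_defs zero_trop_def[symmetric])
    then show ?thesis by (rule rank_one)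
  next
    case row2
    then have "A = outer (vector [1, 0]) (vector [a, b])"
      by (simp add: A outer_def vec2_defs zero_trop_def[symmetric])
    then show ?thesis by (rule rank_one)
  next
    case col1
    then have "A = outer (vector [b, d]) (vector [0, 1])"
      by (simp add: A outer_def vec2_defs zero_trop_def[symmetric])
    then show ?thesis by (rule rank_one)
  next
    case col2
    then have "A = outer (vector [a, c]) (vector [1, 0])"
      by (simp add: A outer_def vec2_defs zero_trop_def[symmetric])
    then show ?thesis by (rule rank_one)
  next
    case diag
    then show ?thesis unfolding A by (intro diagonal[unfolded A]) (simp, rule similar_refl)
  next
    case anti
    then show ?thesis unfolding A by (intro diagonal[unfolded A]) (simp, rule similar_swap_rows)
  next
    case a
    then show ?thesis unfolding A by (intro triangular[unfolded A])
        (simp, rule similar_trans[OF similar_swap_rows similar_swap_columns])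
  next
    case b
    then show ?thesis unfolding A by (intro triangular[unfolded A]) (simp, rule similar_swap_rows)
  next
    case c
    then show ?thesis unfolding A by (intro triangular[unfolded A]) (simp, rule similar_swap_columns)
  next
    case d
    then show ?thesis unfolding A by (intro triangular[unfolded A]) (simp, rule similar_refl)
  next
    case full
    then obtain t where "t \<ge> 0" "similar A (mat22 1 1 1 (Fin t))"
      using similar_normal_form_Fin A by metis
    then show ?thesis by (auto simp: normal_forms_def)
  qed
qed

section \<open>The triples of distances of the normal forms\<close>

text \<open>
  Only as much of each column space is computed as is needed to tell the normal forms apart:
  the end points, which are the projected columns, an inner point of the whole line, and bounds.
\<close>

lemma triple_dists_zero: "triple_dists (PC 0) = {}"
  by (auto simp: triple_dists_def mem_PC_iff)

lemma triple_dists_one: "(\<infinity>, \<infinity>, \<infinity>) \<in> triple_dists (PC (mat 1))"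
proof -
  have "proj v \<in> PC (mat 1)" if "v \<noteq> 0" for v
    using that unfolding mem_PC_iff by (intro exI[of _ v]) simp
  from this[of "vector [1, 0]"] this[of "vector [1, 1]"] this[of "vector [0, 1]"]
  have "-\<infinity> \<in> PC (mat 1)" "0 \<in> PC (mat 1)" "\<infinity> \<in> PC (mat 1)"
    by (simp_all add: proj_def vec2_defs zero_trop_def one_trop_def zero_ereal_def)
  then show ?thesis
    unfolding triple_dists_def
    by (intro CollectI exI[of _ "-\<infinity>"] exI[of _ 0] exI[of _ \<infinity>]) (simp add: delta_def)
qed

lemma triple_dists_NegInf:
  "(0, \<infinity>, \<infinity>) \<in> triple_dists (PC (mat22 1 1 1 NegInf))"
  "(\<infinity>, \<infinity>, \<infinity>) \<notin> triple_dists (PC (mat22 1 1 1 NegInf))"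
proof -
  let ?M = "PC (mat22 1 1 1 NegInf)"
  have "-\<infinity> \<in> ?M" unfolding mem_PC_iff
    by (intro exI[of _ "vector [0, 1]"]) (simp add: proj_def vec2_defs zero_trop_def one_trop_def)
  moreover have "0 \<in> ?M" unfolding mem_PC_iff
    by (intro exI[of _ "vector [1, 0]"])
      (simp add: proj_def vec2_defs zero_trop_def one_trop_def zero_ereal_def)
  ultimately show "(0, \<infinity>, \<infinity>) \<in> triple_dists ?M"
    unfolding triple_dists_def
    by (intro CollectI exI[of _ 0] exI[of _ "-\<infinity>"]) (simp add: delta_def)
  have "x \<noteq> \<infinity>" if x: "x \<in> ?M" for x
  proof -
    obtain v where "mat22 1 1 1 NegInf *v v \<noteq> 0" "x = proj (mat22 1 1 1 NegInf *v v)"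
      using x by (auto simp: mem_PC_iff)
    then show ?thesis
      by (cases "v $ 1"; cases "v $ 2") (auto simp: proj_def vec2_defs one_trop_def zero_trop_def)
  qed
  then show "(\<infinity>, \<infinity>, \<infinity>) \<notin> triple_dists ?M"
    unfolding triple_dists_def by (auto simp: eq_commute[of \<infinity>] delta_eq_PInfty_iff)
qed

lemma triple_dists_Fin:
  assumes "t \<ge> 0"
  shows "(0, ereal t, ereal t) \<in> triple_dists (PC (mat22 1 1 1 (Fin t)))"
    and "(p, q, r) \<in> triple_dists (PC (mat22 1 1 1 (Fin t))) \<Longrightarrow> r \<le> ereal t"
proof -
  let ?M = "PC (mat22 1 1 1 (Fin t))"
  have "0 \<in> ?M" unfolding mem_PC_iff
    by (intro exI[of _ "vector [1, 0]"])
      (simp add: proj_def vec2_defs zero_trop_def one_trop_def zero_ereal_def)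
  moreover have "ereal t \<in> ?M" unfolding mem_PC_iff
    by (intro exI[of _ "vector [0, 1]"]) (simp add: proj_def vec2_defs zero_trop_def one_trop_def)
  ultimately show "(0, ereal t, ereal t) \<in> triple_dists ?M"
    unfolding triple_dists_def using assms
    by (intro CollectI exI[of _ 0] exI[of _ "ereal t"]) (simp add: delta_def)
  have bounds: "\<exists>y. x = ereal y \<and> 0 \<le> y \<and> y \<le> t" if x: "x \<in> ?M" for x
  proof -
    obtain v where "mat22 1 1 1 (Fin t) *v v \<noteq> 0" "x = proj (mat22 1 1 1 (Fin t) *v v)"
      using x by (auto simp: mem_PC_iff)
    then show ?thesis using assms
      by (cases "v $ 1"; cases "v $ 2") (auto simp: proj_def vec2_defs one_trop_def zero_trop_def)
  qed
  show "r \<le> ereal t" if pqr: "(p, q, r) \<in> triple_dists ?M"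
  proof -
    obtain x z where "x \<in> ?M" "z \<in> ?M" "r = delta x z"
      using pqr by (auto simp: triple_dists_def)
    with bounds obtain x' z' where "r = delta (ereal x') (ereal z')" "0 \<le> x'" "x' \<le> t" "0 \<le> z'" "z' \<le> t"
      by metis
    then show ?thesis by (auto simp: delta_def)
  qed
qed

lemma normal_form_unique:
  assumes "M \<in> normal_forms" "N \<in> normal_forms"
    and eq: "triple_dists (PC M) = triple_dists (PC N)"
  shows "M = N"
proof -
  have fin: "(p, \<infinity>, \<infinity>) \<notin> triple_dists (PC (mat22 1 1 1 (Fin t)))" if "t \<ge> 0" for t p
    using triple_dists_Fin(2)[OF that] by force
  have len: "s \<le> t" if "s \<ge> 0" "t \<ge> 0"
    "triple_dists (PC (mat22 1 1 1 (Fin s))) = triple_dists (PC (mat22 1 1 1 (Fin t)))" for s t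
    using triple_dists_Fin[OF that(1)] triple_dists_Fin[OF that(2)] that(3) by (metis ereal_less_eq(3))
  have cases: "N = 0 \<or> N = mat 1 \<or> N = mat22 1 1 1 NegInf \<or> (\<exists>t\<ge>0. N = mat22 1 1 1 (Fin t))"
    if "N \<in> normal_forms" for N
    using that by (auto simp: normal_forms_def)
  note facts = triple_dists_zero triple_dists_one triple_dists_NegInf triple_dists_Fin(1) fin
  from cases[OF assms(1)] cases[OF assms(2)] show ?thesis
    by (elim disjE exE conjE)
      (use eq facts len in \<open>metis empty_iff antisym\<close>)+
qed

section \<open>The four equivalences\<close>

lemma triple_dists_PC_eq_PR: "triple_dists (PC A) = triple_dists (PR A)"
proof -
  obtain N where "N \<in> normal_forms" "similar A N" using ex_similar_normal_form by blast
  then have "delta_isometric (PC A) (PC N)" "delta_isometric (PR A) (PC N)"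
    by (auto simp: similar_def PR_eq_PC_transpose[of N] transpose_normal_form)
  then show ?thesis by (simp add: delta_isometric_imp_triple_dists_eq)
qed

lemma similar_iff_triple_dists_eq: "similar A B \<longleftrightarrow> triple_dists (PC A) = triple_dists (PC B)"
proof
  show imp: "triple_dists (PC A) = triple_dists (PC B)" if "similar A B" for A B
    using that by (simp add: similar_def delta_isometric_imp_triple_dists_eq)
  assume eq: "triple_dists (PC A) = triple_dists (PC B)"
  obtain M N where M: "M \<in> normal_forms" "similar A M" and N: "N \<in> normal_forms" "similar B N"
    using ex_similar_normal_form by metis
  have "triple_dists (PC M) = triple_dists (PC N)"
    using imp[OF M(2)] imp[OF N(2)] eq by simp
  then have "M = N" using M(1) N(1) normal_form_unique by blast
  then show "similar A B" using M(2) N(2) similar_sym similar_trans by blast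
qed

text \<open>
  One factor is handled through the column space and the other one through the row space; between
  the two the invariant is carried from one space to the other.
\<close>

lemma green_J_imp_triple_dists_eq:
  assumes "(A, B) \<in> green_J M2"
  shows "triple_dists (PC A) = triple_dists (PC B)"
proof -
  have sub: "triple_dists (PC A) \<subseteq> triple_dists (PC B)" if J: "(A, B) \<in> green_J M2" for A B
  proof -
    obtain X Y where A: "A = X ** B ** Y"
      using monoid.green_J_divides[OF monoid_M2 J] by auto
    have "triple_dists (PC A) \<subseteq> triple_dists (PC (X ** B))"
      unfolding A by (intro triple_dists_mono PC_mult_right_subset)
    also have "\<dots> = triple_dists (PR (X ** B))" by (rule triple_dists_PC_eq_PR)
    also have "\<dots> \<subseteq> triple_dists (PR B)" by (intro triple_dists_mono PR_mult_left_subset)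
    also have "\<dots> = triple_dists (PC B)" by (rule triple_dists_PC_eq_PR[symmetric])
    finally show ?thesis .
  qed
  show ?thesis using sub[OF assms] sub[OF green_J_sym[OF assms]] by blast
qed

theorem theorem3p7:
  fixes A B :: "trop^2^2"
  shows "((A, B) \<in> green_D M2 \<longleftrightarrow> (A, B) \<in> green_J M2)
    \<and> ((A, B) \<in> green_J M2 \<longleftrightarrow> delta_isometric (PC A) (PC B))
    \<and> (delta_isometric (PC A) (PC B) \<longleftrightarrow> delta_isometric (PR A) (PR B))"
proof -
  have "similar A B" if "(A, B) \<in> green_J M2"
    using green_J_imp_triple_dists_eq[OF that] by (simp add: similar_iff_triple_dists_eq)
  moreover have "(A, B) \<in> green_J M2" if "(A, B) \<in> green_D M2"
    using monoid.green_D_subset_J[OF monoid_M2] that by blast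
  moreover have "similar A B" if "delta_isometric (PC A) (PC B)"
    using delta_isometric_imp_triple_dists_eq[OF that] by (simp add: similar_iff_triple_dists_eq)
  moreover have "similar A B" if "delta_isometric (PR A) (PR B)"
    using delta_isometric_imp_triple_dists_eq[OF that]
    by (simp add: similar_iff_triple_dists_eq triple_dists_PC_eq_PR)
  ultimately show ?thesis unfolding similar_def by blast
qed

end
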